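(* Let $\{X_t:t\ge0\}$ be an irreducible, transient continuous-time Markov process on a countable state space $E$ with generator $L$, admitting a stationary measure $\mu$. Let $f:E\to\mathbb R$ be a finitely supported function and let $\{A_n: n\ge1\}$ be an increasing sequence of finite sets with $E=\bigcup_{n\ge1}A_n$. Then, for every $x\in E$, $$\mu(x)\,f(x)^2\;\le\;G(x,x)\,\lim_{n\to\infty}\,\sup_{H\in\mathfrak B_n}\Big\{2\langle L^*f,H\rangle_\mu-\langle H,(-S)H\rangle_\mu\Big\},$$ where $\mathfrak B_n$ is the set of functions $H:E\to\mathbb R$ which vanish on $A_n^c$.
   Context: $X_t$ has holding rates $\lambda(x)$ and jump rates $r(x,y)$ ($x\ne y$), with $\lambda(x)=\sum_y r(x,y)$; its law on right-continuous paths with left limits $D(\mathbb R_+,E)$ started at $x$ is $\mathbb P_x$, with expectation $\mathbb E_x$. The stationary measure $\mu$ (not necessarily finite, $\mu(x)>0$) satisfies $\sum_y\mu(y)r(y,x)=\mu(x)\lambda(x)$. $(Lf)(x)=\sum_y r(x,y)[f(y)-f(x)]$; $L^*$ is the generator of the adjoint process, with jump rates $r^*(x,y)$ given by $\mu(x)r(x,y)=\mu(y)r^*(y,x)$, i.e. $(L^*f)(x)=\sum_y r^*(x,y)[f(y)-f(x)]$; $S=\frac12(L+L^* )$. $\langle f,g\rangle_\mu=\sum_x\mu(x)f(x)g(x)$. The Green function is $G(x,y)=\mathbb E_x\big[\int_0^\infty \mathbf 1\{X_t=y\}\,dt\big]$. (The suprema are nondecreasing in $n$, so the limit exists in $[0,\infty]$.)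 *)

theory Defs
  imports "HOL-Probability.Probability"
begin

section \<open>Paths\<close>

text \<open>The state space is a countable type carrying the discrete topology, so that convergence of
  \<open>\<omega> s\<close> to \<open>y\<close> means that \<open>\<omega> s = y\<close> eventually. Limits being required to lie in the state space,
  such a path has finitely many jumps in every bounded time interval (there is no explosion).\<close>

definition cadlag_paths :: "(real \<Rightarrow> 'a) set" where
  "cadlag_paths = {\<omega> \<in> extensional {0..}.
     (\<forall>t\<ge>0. \<forall>\<^sub>F s in at_right t. \<omega> s = \<omega> t) \<and>
     (\<forall>t>0. \<exists>y. \<forall>\<^sub>F s in at_left t. \<omega> s = y)}"

definition path_space :: "(real \<Rightarrow> 'a) measure" where
  "path_space = restrict_space (PiM {0..} (\<lambda>_. count_space UNIV)) cadlag_paths"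

definition past :: "real \<Rightarrow> (real \<Rightarrow> 'a) set set" where
  "past s = sigma_sets cadlag_paths {{\<omega> \<in> cadlag_paths. \<omega> u = y} | u y. 0 \<le> u \<and> u \<le> s}"

definition shift :: "real \<Rightarrow> (real \<Rightarrow> 'a) \<Rightarrow> real \<Rightarrow> 'a" where
  "shift s \<omega> = (\<lambda>t\<in>{0..}. \<omega> (s + t))"

text \<open>The time of the first jump, \<open>\<infinity>\<close> if the path is constant.\<close>

definition jump_time :: "(real \<Rightarrow> 'a) \<Rightarrow> ereal" where
  "jump_time \<omega> = (INF t\<in>{t. 0 \<le> t \<and> \<omega> t \<noteq> \<omega> 0}. ereal t)"

section \<open>Markov jump processes\<close>

definition holding_rate :: "('a \<Rightarrow> 'a \<Rightarrow> real) \<Rightarrow> 'a \<Rightarrow> real" where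
  "holding_rate r x = (\<Sum>\<^sub>\<infinity>y. r x y)"

text \<open>Only the rates \<open>r x y\<close> with \<open>x \<noteq> y\<close> are meaningful; the diagonal is set to \<open>0\<close>.\<close>

locale jump_rates =
  fixes r :: "'a::countable \<Rightarrow> 'a \<Rightarrow> real"
  assumes rate_nonneg: "r x y \<ge> 0"
    and rate_diag: "r x x = 0"
    and rate_summable: "r x summable_on UNIV"

text \<open>\<open>P x\<close> is the law of the process started at \<open>x\<close>. Under \<open>P x\<close> the first jump time is
  exponential with parameter \<open>holding_rate r x\<close>, and it is independent of the state entered at that
  time, which is \<open>y\<close> with probability \<open>r x y / holding_rate r x\<close>. If \<open>holding_rate r x = 0\<close>
  then \<open>r x y / holding_rate r x = 0\<close>, and the assumptions say that \<open>x\<close> is absorbing.\<close>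

locale markov_jump_process = jump_rates r
  for r :: "'a::countable \<Rightarrow> 'a \<Rightarrow> real" +
  fixes P :: "'a \<Rightarrow> (real \<Rightarrow> 'a) measure"
  assumes law_prob_space: "prob_space (P x)"
    and law_space: "space (P x) = space path_space"
    and law_sets: "sets (P x) = sets path_space"
    and law_start: "AE \<omega> in P x. \<omega> 0 = x"
    and markov_property:
      "\<lbrakk>0 \<le> s; A \<in> past s; B \<in> sets path_space\<rbrakk> \<Longrightarrow>
        measure (P x) {\<omega> \<in> A. \<omega> s = y \<and> shift s \<omega> \<in> B} =
        measure (P x) {\<omega> \<in> A. \<omega> s = y} * measure (P y) B"
    and holding_time:
      "0 \<le> t \<Longrightarrow>
        measure (P x) {\<omega> \<in> space (P x). ereal t < jump_time \<omega>} = exp (- holding_rate r x * t)"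
    and jump_law:
      "0 \<le> t \<Longrightarrow>
        measure (P x) {\<omega> \<in> space (P x). ereal t < jump_time \<omega> \<and> jump_time \<omega> < \<infinity> \<and>
                                        \<omega> (real_of_ereal (jump_time \<omega>)) = y} =
        exp (- holding_rate r x * t) * (r x y / holding_rate r x)"

definition irreducible_process :: "('a \<Rightarrow> (real \<Rightarrow> 'a) measure) \<Rightarrow> bool" where
  "irreducible_process P \<longleftrightarrow>
     (\<forall>x y. \<exists>t\<ge>0. measure (P x) {\<omega> \<in> space (P x). \<omega> t = y} > 0)"

definition transient_process :: "('a \<Rightarrow> (real \<Rightarrow> 'a) measure) \<Rightarrow> bool" where
  "transient_process P \<longleftrightarrow> (\<forall>x. AE \<omega> in P x. bounded {t. 0 \<le> t \<and> \<omega> t = x})"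

definition green :: "('a \<Rightarrow> (real \<Rightarrow> 'a) measure) \<Rightarrow> 'a \<Rightarrow> 'a \<Rightarrow> ennreal" where
  "green P x y = (\<integral>\<^sup>+\<omega>. (\<integral>\<^sup>+t\<in>{0..}. indicator {y} (\<omega> t) \<partial>lborel) \<partial>P x)"

definition stationary_measure :: "('a \<Rightarrow> 'a \<Rightarrow> real) \<Rightarrow> ('a \<Rightarrow> real) \<Rightarrow> bool" where
  "stationary_measure r \<mu> \<longleftrightarrow>
     (\<forall>x. \<mu> x > 0) \<and> (\<forall>x. ((\<lambda>y. \<mu> y * r y x) has_sum (\<mu> x * holding_rate r x)) UNIV)"

section \<open>Generators and the inner product\<close>

definition gen :: "('a \<Rightarrow> 'a \<Rightarrow> real) \<Rightarrow> ('a \<Rightarrow> real) \<Rightarrow> 'a \<Rightarrow> real" where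
  "gen r f x = (\<Sum>\<^sub>\<infinity>y. r x y * (f y - f x))"

text \<open>The solution of \<open>\<mu> x * r x y = \<mu> y * adj_rate \<mu> r y x\<close>.\<close>

definition adj_rate :: "('a \<Rightarrow> real) \<Rightarrow> ('a \<Rightarrow> 'a \<Rightarrow> real) \<Rightarrow> 'a \<Rightarrow> 'a \<Rightarrow> real" where
  "adj_rate \<mu> r x y = \<mu> y * r y x / \<mu> x"

definition adj_gen :: "('a \<Rightarrow> real) \<Rightarrow> ('a \<Rightarrow> 'a \<Rightarrow> real) \<Rightarrow> ('a \<Rightarrow> real) \<Rightarrow> 'a \<Rightarrow> real" where
  "adj_gen \<mu> r = gen (adj_rate \<mu> r)"

definition sym_gen :: "('a \<Rightarrow> real) \<Rightarrow> ('a \<Rightarrow> 'a \<Rightarrow> real) \<Rightarrow> ('a \<Rightarrow> real) \<Rightarrow> 'a \<Rightarrow> real" where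
  "sym_gen \<mu> r f x = (gen r f x + adj_gen \<mu> r f x) / 2"

definition inner_mu :: "('a \<Rightarrow> real) \<Rightarrow> ('a \<Rightarrow> real) \<Rightarrow> ('a \<Rightarrow> real) \<Rightarrow> real" where
  "inner_mu \<mu> f g = (\<Sum>\<^sub>\<infinity>x. \<mu> x * f x * g x)"

definition vanishing_off :: "'a set \<Rightarrow> ('a \<Rightarrow> real) set" where
  "vanishing_off A = {H. \<forall>x. x \<notin> A \<longrightarrow> H x = 0}"

end

theory Submission
  imports Defs
begin

text \<open>Let \<open>H y\<close> be the Green function at \<open>(y, x)\<close> of the process killed on leaving a set \<open>A n\<close> that
  contains \<open>x\<close> and the support of \<open>f\<close>. Since \<open>L H = - 1\<^bsub>x\<^esub>\<close> on \<open>A n\<close>, summation by parts shows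
  that the functional takes the value \<open>\<mu> x * (f x)\<^sup>2 / H x\<close> at \<open>- f x / H x\<close> times \<open>H\<close>, and
  \<open>H x \<le> G x x\<close>.

  This comparison needs only that \<open>g y = G y x\<close> is finite and satisfies
  \<open>1\<^bsub>x\<^esub> y + (\<Sum>z\<in>B. r y z * g z) \<le> \<lambda> y * g y\<close> for finite \<open>B\<close>. The inequality is the limit for
  \<open>h \<rightarrow> 0\<close> of \<open>g y \<ge> \<integral>\<^bsub>0\<^esub>\<^bsup>h\<^esup> p t y x dt + (\<Sum>z. p h y z * g z)\<close>, where \<open>p h y z / h\<close> is bounded
  below by a sequence converging to \<open>r y z\<close>, which follows from the law of the first jump. Finiteness
  comes from transience: if \<open>q\<close> is the probability of no return to \<open>x\<close> at positive integer times,
  then \<open>(\<Sum>k. p k x x) * q = 1\<close>.\<close>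

section \<open>Paths\<close>

lemma space_path_space: "space path_space = cadlag_paths"
  by (auto simp: path_space_def space_restrict_space space_PiM cadlag_paths_def PiE_def)

lemma measurable_coordinate: "(\<lambda>\<omega>. \<omega> t) \<in> measurable path_space (count_space UNIV)"
proof (cases "t \<ge> 0")
  case True
  then show ?thesis
    unfolding path_space_def
    by (intro measurable_restrict_space1 measurable_component_singleton) auto
next
  case False
  \<comment> \<open>At negative times every path takes the default value \<open>undefined\<close>,
    because paths are extensional on \<open>{0..}\<close>.\<close>
  have "(\<lambda>\<omega>. undefined) \<in> measurable path_space (count_space UNIV)" by simp
  moreover have "\<omega> t = undefined" if "\<omega> \<in> space path_space" for \<omega> :: "real \<Rightarrow> 'a"
    using that False by (auto simp: space_path_space cadlag_paths_def extensional_def)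
  ultimately show ?thesis by (subst measurable_cong[where g = "\<lambda>\<omega>. undefined"])
qed

lemma shift_apply: "0 \<le> t \<Longrightarrow> shift s \<omega> t = \<omega> (s + t)"
  by (simp add: shift_def)

lemma cadlag_shift:
  assumes "\<omega> \<in> cadlag_paths" "0 \<le> s"
  shows "shift s \<omega> \<in> cadlag_paths"
proof -
  have "\<forall>\<^sub>F u in at_right t. shift s \<omega> u = shift s \<omega> t" if "0 \<le> t" for t
  proof -
    have "\<forall>\<^sub>F u in at_right (s + t). \<omega> u = \<omega> (s + t)"
      using assms that by (auto simp: cadlag_paths_def)
    then obtain b where b: "b > s + t" "\<And>u. s + t < u \<Longrightarrow> u < b \<Longrightarrow> \<omega> u = \<omega> (s + t)"
      by (auto simp: eventually_at_right_field)
    show ?thesis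
      unfolding eventually_at_right_field
      by (rule exI[of _ "b - s"]) (use b that in \<open>auto simp: shift_apply\<close>)
  qed
  moreover have "\<exists>y. \<forall>\<^sub>F u in at_left t. shift s \<omega> u = y" if "0 < t" for t
  proof -
    have "0 < s + t" using assms that by simp
    then obtain y where "\<forall>\<^sub>F u in at_left (s + t). \<omega> u = y"
      using assms(1) by (auto simp: cadlag_paths_def)
    then obtain b where b: "b < s + t" "\<And>u. b < u \<Longrightarrow> u < s + t \<Longrightarrow> \<omega> u = y"
      by (auto simp: eventually_at_left_field)
    have "\<forall>\<^sub>F u in at_left t. shift s \<omega> u = y"
      unfolding eventually_at_left_field
      by (rule exI[of _ "max 0 (b - s)"]) (use b that in \<open>auto simp: shift_apply\<close>)
    then show ?thesis by blast
  qed
  ultimately show ?thesis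
    by (auto simp: cadlag_paths_def) (auto simp: shift_def)
qed

text \<open>In a discrete state space, right continuity gives eventual equality along approximations
  from above, not mere convergence. This is why times are always rounded up in what follows.\<close>

lemma right_limit_approx:
  assumes "\<omega> \<in> cadlag_paths" "0 \<le> t" "u \<longlonglongrightarrow> t" "\<And>n. t \<le> u n"
  shows "\<forall>\<^sub>F n in sequentially. \<omega> (u n) = \<omega> t"
proof -
  obtain b where b: "b > t" "\<And>s. t < s \<Longrightarrow> s < b \<Longrightarrow> \<omega> s = \<omega> t"
    using assms by (auto simp: cadlag_paths_def eventually_at_right_field)
  have "\<forall>\<^sub>F n in sequentially. u n < b" using assms b by (auto dest: order_tendstoD)
  then show ?thesis
    by eventually_elim (metis assms(4) b(2) order_le_less)
qed

text \<open>The strict inequality survives taking the infimum because right continuity keeps the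
  path constant a little beyond \<open>s\<close>.\<close>

lemma jump_time_gt_iff:
  assumes "\<omega> \<in> cadlag_paths" "0 \<le> s"
  shows "ereal s < jump_time \<omega> \<longleftrightarrow> (\<forall>u. 0 \<le> u \<and> u \<le> s \<longrightarrow> \<omega> u = \<omega> 0)"
proof
  assume *: "ereal s < jump_time \<omega>"
  show "\<forall>u. 0 \<le> u \<and> u \<le> s \<longrightarrow> \<omega> u = \<omega> 0"
  proof (intro allI impI, rule ccontr)
    fix u assume u: "0 \<le> u \<and> u \<le> s" "\<omega> u \<noteq> \<omega> 0"
    then have "jump_time \<omega> \<le> ereal u"
      unfolding jump_time_def by (intro INF_lower) auto
    with * u show False by (metis ereal_less_eq(3) leD order_trans)
  qed
next
  assume *: "\<forall>u. 0 \<le> u \<and> u \<le> s \<longrightarrow> \<omega> u = \<omega> 0"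
  obtain b where b: "b > s" "\<And>u. s < u \<Longrightarrow> u < b \<Longrightarrow> \<omega> u = \<omega> s"
    using assms by (auto simp: cadlag_paths_def eventually_at_right_field)
  have "ereal b \<le> jump_time \<omega>"
    unfolding jump_time_def
  proof (intro INF_greatest)
    fix t assume "t \<in> {t. 0 \<le> t \<and> \<omega> t \<noteq> \<omega> 0}"
    then have t: "0 \<le> t" "\<omega> t \<noteq> \<omega> 0" by auto
    have "\<not> t \<le> s" using * t by blast
    moreover have "\<omega> s = \<omega> 0" using * assms(2) by blast
    ultimately have "\<not> t < b" using b(2)[of t] t by auto
    then show "ereal b \<le> ereal t" by simp
  qed
  moreover have "ereal s < ereal b" using b by simp
  ultimately show "ereal s < jump_time \<omega>" by (rule less_le_trans[rotated])
qed

section \<open>Events determined by the path up to a fixed time\<close>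

lemma past_subset: "past s \<subseteq> sets path_space"
proof -
  have "{\<omega> \<in> cadlag_paths. \<omega> u = y} \<in> sets path_space" for u y
    using measurable_sets[OF measurable_coordinate[of u], of "{y}"]
    by (simp add: space_path_space vimage_def Int_def conj_commute)
  then have "{{\<omega> \<in> cadlag_paths. \<omega> u = y} |u y. 0 \<le> u \<and> u \<le> s} \<subseteq> sets path_space"
    by auto
  then show ?thesis
    unfolding past_def using sets.sigma_sets_subset[of _ path_space] by (simp add: space_path_space)
qed

lemma sigma_algebra_past: "sigma_algebra cadlag_paths (past s)"
  unfolding past_def by (intro sigma_algebra_sigma_sets) auto

lemma cadlag_in_past: "cadlag_paths \<in> past s"
  unfolding past_def by (rule sigma_sets_top)

lemma coordinate_in_past: "0 \<le> u \<Longrightarrow> u \<le> s \<Longrightarrow> {\<omega> \<in> cadlag_paths. \<omega> u = y} \<in> past s"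
  unfolding past_def by (intro sigma_sets.Basic) auto

text \<open>By right continuity, constancy on \<open>[0, s]\<close> can be tested at the countably
  many times \<open>s * q\<close> with \<open>q\<close> rational in \<open>[0, 1]\<close>, all of
  which belong to the past of \<open>s\<close>.\<close>

lemma jump_time_gt_past:
  assumes "0 \<le> s"
  shows "{\<omega> \<in> cadlag_paths. ereal s < jump_time \<omega>} \<in> (past s :: (real \<Rightarrow> 'a::countable) set set)"
proof -
  interpret sigma_algebra cadlag_paths "past s :: (real \<Rightarrow> 'a) set set" by (rule sigma_algebra_past)
  define Q where "Q = {q::rat. 0 \<le> q \<and> q \<le> 1}"
  have "ereal s < jump_time \<omega> \<longleftrightarrow> (\<forall>q\<in>Q. \<exists>y. \<omega> 0 = y \<and> \<omega> (s * of_rat q) = y)"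
    if w: "\<omega> \<in> cadlag_paths" for \<omega> :: "real \<Rightarrow> 'a"
    unfolding jump_time_gt_iff[OF w assms]
  proof safe
    fix q assume *: "\<forall>u. 0 \<le> u \<and> u \<le> s \<longrightarrow> \<omega> u = \<omega> 0" and q: "q \<in> Q"
    have "0 \<le> s * of_rat q" "s * of_rat q \<le> s"
      using q assms by (simp_all add: Q_def mult_left_le)
    then show "\<exists>y. \<omega> 0 = y \<and> \<omega> (s * of_rat q) = y"
      using * by blast
  next
    fix u assume *: "\<forall>q\<in>Q. \<exists>y. \<omega> 0 = y \<and> \<omega> (s * of_rat q) = y" and u: "0 \<le> u" "u \<le> s"
    show "\<omega> u = \<omega> 0"
    proof (cases "u = s")
      \<comment> \<open>To the right of \<open>s\<close> there is no test time left, so the endpoint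
        is tested directly through \<open>q = 1\<close>.\<close>
      case True
      then show ?thesis using *[rule_format, of 1] by (auto simp: Q_def)
    next
      case False
      obtain b where b: "b > u" "\<And>v. u < v \<Longrightarrow> v < b \<Longrightarrow> \<omega> v = \<omega> u"
        using w u by (auto simp: cadlag_paths_def eventually_at_right_field)
      have s: "s > 0" using u False by linarith
      have "u / s < min b s / s" using b u False s by (intro divide_strict_right_mono) auto
      then obtain q where q: "u / s < of_rat q" "of_rat q < min b s / s"
        using of_rat_dense by blast
      then have q': "u < s * of_rat q" "s * of_rat q < min b s"
        using s by (auto simp: field_simps)
      have "0 \<le> q" using q(1) u s
        by (metis divide_nonneg_pos less_eq_real_def order_le_less_trans zero_le_of_rat_iff)
      moreover have "q \<le> 1" 
      proof -
        have "s * real_of_rat q < s * 1" using q' by linarith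
        then have "real_of_rat q \<le> 1" using s by simp
        then show ?thesis by (metis of_rat_1 of_rat_less_eq)
      qed
      ultimately show ?thesis using * q' b(2)[of "s * of_rat q"] by (auto simp: Q_def)
    qed
  qed
  then have "{\<omega> \<in> cadlag_paths. ereal s < jump_time \<omega>} =
      {\<omega> \<in> cadlag_paths. \<forall>q. q \<in> Q \<longrightarrow> (\<exists>y. \<omega> 0 = y \<and> \<omega> (s * of_rat q) = (y :: 'a))}"
    by blast
  also have "\<dots> \<in> past s"
  proof (intro sets_Collect_countable_All)
    fix q :: rat
    show "{\<omega> \<in> cadlag_paths. q \<in> Q \<longrightarrow> (\<exists>y. \<omega> 0 = y \<and> \<omega> (s * of_rat q) = (y :: 'a))} \<in> past s"
    proof (cases "q \<in> Q")
      case True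
      then have "0 \<le> s * real_of_rat q" "s * real_of_rat q \<le> s"
        using assms by (simp_all add: Q_def mult_left_le)
      then have "{\<omega> \<in> cadlag_paths. \<exists>y. \<omega> 0 = y \<and> \<omega> (s * of_rat q) = (y :: 'a)} \<in> past s"
        using assms
        by (intro sets_Collect_countable_Ex sets_Collect_conj coordinate_in_past) auto
      with True show ?thesis by (simp del: ex_simps)
    qed (use cadlag_in_past in simp)
  qed
  finally show ?thesis .
qed

section \<open>Transition probabilities\<close>

lemma disjoint_family_linorder:
  fixes E :: "'i::linorder \<Rightarrow> 'b set"
  assumes "\<And>i j. i < j \<Longrightarrow> E i \<inter> E j = {}"
  shows "disjoint_family E"
  unfolding disjoint_family_on_def
proof (intro ballI impI)
  fix i j :: 'i assume "i \<noteq> j"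
  then consider "i < j" | "j < i" by (rule linorder_neqE)
  then show "E i \<inter> E j = {}"
    by cases (use assms[of i j] assms[of j i] in \<open>simp_all only: Int_commute\<close>)
qed

text \<open>A difference quotient of the exponential at \<open>0\<close> with increment
  \<open>1 / (n + 1)\<close>. It turns probabilities of leaving a state into rates.\<close>

lemma mult_one_minus_exp_LIMSEQ:
  "(\<lambda>n. real (Suc n) * (1 - exp (- c / real (Suc n)))) \<longlonglongrightarrow> c"
proof -
  have "((\<lambda>h. (exp (- c * h) - exp (- c * 0)) / (h - 0)) \<longlongrightarrow> - c) (at 0)"
  proof -
    have "((\<lambda>h. exp (- c * h)) has_field_derivative - c) (at 0)"
      by (auto intro!: derivative_eq_intros)
    then show ?thesis by (simp add: has_field_derivative_iff)
  qed
  then have "((\<lambda>h. (exp (- c * h) - 1) / h) \<longlongrightarrow> - c) (at 0)" by simp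
  moreover have "filterlim (\<lambda>n. inverse (real (Suc n))) (at 0) sequentially"
    using LIMSEQ_inverse_real_of_nat by (auto simp: filterlim_at)
  ultimately have "(\<lambda>n. (exp (- c * inverse (real (Suc n))) - 1) / inverse (real (Suc n)))
      \<longlonglongrightarrow> - c"
    by (rule filterlim_compose)
  from tendsto_minus[OF this] show ?thesis
    by (simp add: field_simps)
qed

definition trans_prob :: "('a \<Rightarrow> (real \<Rightarrow> 'a) measure) \<Rightarrow> real \<Rightarrow> 'a \<Rightarrow> 'a \<Rightarrow> real" where
  "trans_prob P t x y = measure (P x) {\<omega> \<in> space (P x). \<omega> t = y}"

lemma trans_prob_nonneg: "0 \<le> trans_prob P t x y"
  by (simp add: trans_prob_def)

context jump_rates
begin

lemma holding_rate_nonneg: "0 \<le> holding_rate r x"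
  unfolding holding_rate_def by (intro infsum_nonneg rate_nonneg)

lemma rate_eq_0: "holding_rate r x = 0 \<Longrightarrow> r x y = 0"
  using rate_summable rate_nonneg unfolding holding_rate_def
  by (intro nonneg_infsum_le_0D[where A = UNIV]) auto

end

context markov_jump_process
begin

lemma space_law: "space (P x) = cadlag_paths"
  by (simp add: law_space space_path_space)

lemma coordinate_measurable_law [measurable]: "(\<lambda>\<omega>. \<omega> t) \<in> measurable (P x) (count_space UNIV)"
  using measurable_coordinate[of t] measurable_cong_sets[OF law_sets refl, of x] by blast

lemma past_sets_law: "A \<in> past s \<Longrightarrow> A \<in> sets (P x)"
  using past_subset by (auto simp: law_sets)

lemma past_subset_cadlag: "A \<in> past s \<Longrightarrow> A \<subseteq> cadlag_paths"
  using sets.sets_into_space[of A path_space] past_subset by (auto simp: space_path_space)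

lemma jump_time_gt_sets_law: "0 \<le> s \<Longrightarrow> {\<omega> \<in> cadlag_paths. ereal s < jump_time \<omega>} \<in> sets (P x)"
  by (rule past_sets_law, rule jump_time_gt_past)

text \<open>The Markov property for a future event that fixes one coordinate. The past event
  \<open>A\<close> stays general so that "no jump up to time \<open>s\<close>" can be inserted in
  \<open>jump_on_mesh\<close>.\<close>

lemma markov_trans_prob:
  assumes "0 \<le> s" "0 \<le> t" "A \<in> past s"
  shows "measure (P x) {\<omega> \<in> A. \<omega> s = y \<and> \<omega> (s + t) = z} =
    measure (P x) {\<omega> \<in> A. \<omega> s = y} * trans_prob P t y z"
proof -
  let ?B = "{\<omega> \<in> cadlag_paths. \<omega> t = z}"
  have "?B \<in> sets path_space"
    using coordinate_in_past[OF assms(2) order_refl, of z] past_subset[of t] by (rule subsetD[rotated])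
  from markov_property[OF assms(1,3) this, of x y]
  have "measure (P x) {\<omega> \<in> A. \<omega> s = y \<and> shift s \<omega> \<in> ?B} =
      measure (P x) {\<omega> \<in> A. \<omega> s = y} * trans_prob P t y z"
    by (simp add: trans_prob_def space_law)
  also have "{\<omega> \<in> A. \<omega> s = y \<and> shift s \<omega> \<in> ?B} = {\<omega> \<in> A. \<omega> s = y \<and> \<omega> (s + t) = z}"
    using assms past_subset_cadlag[OF assms(3)] by (auto simp: shift_apply intro: cadlag_shift)
  finally show ?thesis .
qed

text \<open>The lower half of the Chapman-Kolmogorov equation: only paths that pass through
  \<open>F\<close> at time \<open>s\<close> are counted.\<close>

lemma trans_prob_add_ge:
  assumes "finite F" "0 \<le> s" "0 \<le> t"
  shows "(\<Sum>z\<in>F. trans_prob P s x z * trans_prob P t z y) \<le> trans_prob P (s + t) x y"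
proof -
  interpret prob_space "P x" by (rule law_prob_space)
  have *: "{\<omega> \<in> cadlag_paths. \<omega> s = z \<and> \<omega> (s + t) = y} \<in> sets (P x)" for z
    unfolding space_law[of x, symmetric] by measurable
  have "(\<Sum>z\<in>F. trans_prob P s x z * trans_prob P t z y) =
      (\<Sum>z\<in>F. prob {\<omega> \<in> cadlag_paths. \<omega> s = z \<and> \<omega> (s + t) = y})"
    using markov_trans_prob[OF assms(2,3) cadlag_in_past] by (simp add: trans_prob_def space_law)
  also have "\<dots> = prob (\<Union>z\<in>F. {\<omega> \<in> cadlag_paths. \<omega> s = z \<and> \<omega> (s + t) = y})"
    using assms(1) * by (intro finite_measure_finite_Union[symmetric]) (auto simp: disjoint_family_on_def)
  also have "\<dots> \<le> prob {\<omega> \<in> cadlag_paths. \<omega> (s + t) = y}"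
    by (intro finite_measure_mono) (auto simp: space_law[of x, symmetric])
  finally show ?thesis by (simp add: trans_prob_def space_law)
qed

text \<open>A path without a jump up to time \<open>t\<close> is still at its starting
  point.\<close>

lemma trans_prob_same_ge:
  assumes "0 \<le> t"
  shows "exp (- holding_rate r x * t) \<le> trans_prob P t x x"
proof -
  interpret prob_space "P x" by (rule law_prob_space)
  have "exp (- holding_rate r x * t) = prob {\<omega> \<in> space (P x). ereal t < jump_time \<omega>}"
    using holding_time[OF assms] by simp
  also have "\<dots> \<le> prob {\<omega> \<in> space (P x). \<omega> t = x}"
  proof (rule finite_measure_mono_AE)
    show "AE \<omega> in P x. \<omega> \<in> {\<omega> \<in> space (P x). ereal t < jump_time \<omega>} \<longrightarrow>
        \<omega> \<in> {\<omega> \<in> space (P x). \<omega> t = x}"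
      using law_start[of x] by eventually_elim (use assms jump_time_gt_iff[OF _ assms] in \<open>auto simp: space_law\<close>)
  qed auto
  finally show ?thesis by (simp add: trans_prob_def)
qed

section \<open>Short-time transition probabilities and jump rates\<close>

text \<open>Without a jump up to \<open>k * h\<close> the path sits at \<open>x\<close> at that
  time, and the Markov property restarts it there. Being at \<open>y\<close> one mesh step later
  then has probability \<open>trans_prob P h x y\<close>, and it already forces a jump because
  \<open>y\<close> differs from \<open>x\<close>.\<close>

lemma jump_on_mesh:
  assumes "y \<noteq> x" "0 \<le> h"
  defines "E \<equiv> \<lambda>k. {\<omega> \<in> cadlag_paths. ereal (real k * h) < jump_time \<omega> \<and>
      \<not> ereal (real (Suc k) * h) < jump_time \<omega> \<and> \<omega> (real (Suc k) * h) = y}"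
  shows "E k \<in> sets (P x)"
    and "measure (P x) (E k) = exp (- holding_rate r x * h) ^ k * trans_prob P h x y"
proof -
  have s: "0 \<le> real k * h" "0 \<le> real (Suc k) * h" using assms by auto
  let ?A = "{\<omega> \<in> cadlag_paths. ereal (real k * h) < jump_time \<omega>} :: (real \<Rightarrow> 'a) set"
  have A: "?A \<in> past (real k * h)" by (rule jump_time_gt_past[OF s(1)])
  have "{\<omega> \<in> space (P x). \<omega> (real (Suc k) * h) = y} \<in> sets (P x)" by measurable
  moreover have "E k = (?A - {\<omega> \<in> cadlag_paths. ereal (real (Suc k) * h) < jump_time \<omega>}) \<inter>
      {\<omega> \<in> space (P x). \<omega> (real (Suc k) * h) = y}"
    by (auto simp: E_def space_law)
  moreover have A': "?A \<in> sets (P x)" using A by (rule past_sets_law)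
  ultimately show E: "E k \<in> sets (P x)"
    using jump_time_gt_sets_law[OF s(2), of x] by (simp only: sets.Int sets.Diff)
  have eq: "real (Suc k) * h = real k * h + h" by (simp add: algebra_simps)
  have "measure (P x) (E k) = measure (P x) {\<omega> \<in> ?A. \<omega> (real k * h) = x \<and> \<omega> (real k * h + h) = y}"
  proof (rule measure_eq_AE)
    show "AE \<omega> in P x. (\<omega> \<in> E k) = (\<omega> \<in> {\<omega> \<in> ?A. \<omega> (real k * h) = x \<and> \<omega> (real k * h + h) = y})"
      using law_start[of x]
    proof eventually_elim
      case (elim \<omega>)
      show ?case
      proof (cases "\<omega> \<in> ?A")
        case True
        then have w: "\<omega> \<in> cadlag_paths" by simp
        have "\<omega> (real k * h) = x"
          using True elim jump_time_gt_iff[OF w s(1)] s(1) by blast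
        moreover have "\<not> ereal (real (Suc k) * h) < jump_time \<omega>" if "\<omega> (real (Suc k) * h) = y"
          using that elim assms(1) s(2) jump_time_gt_iff[OF w s(2)] by blast
        ultimately show ?thesis using True unfolding eq E_def by auto
      qed (auto simp: E_def)
    qed
    have "{\<omega> \<in> space (P x). \<omega> (real k * h) = x \<and> \<omega> (real k * h + h) = y} \<in> sets (P x)"
      by measurable
    then have "?A \<inter> {\<omega> \<in> space (P x). \<omega> (real k * h) = x \<and> \<omega> (real k * h + h) = y} \<in> sets (P x)"
      using A' by blast
    also have "?A \<inter> {\<omega> \<in> space (P x). \<omega> (real k * h) = x \<and> \<omega> (real k * h + h) = y} =
        {\<omega> \<in> ?A. \<omega> (real k * h) = x \<and> \<omega> (real k * h + h) = y}"
      by (auto simp: space_law)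
    finally show "{\<omega> \<in> ?A. \<omega> (real k * h) = x \<and> \<omega> (real k * h + h) = y} \<in> sets (P x)" .
  qed (rule E)
  also have "\<dots> = measure (P x) {\<omega> \<in> ?A. \<omega> (real k * h) = x} * trans_prob P h x y"
    by (rule markov_trans_prob[OF s(1) assms(2) A])
  \<comment> \<open>Almost surely the condition \<open>\<omega> (real k * h) = x\<close> is implied
    by \<open>?A\<close>, so the holding time law gives the factor.\<close>
  also have "measure (P x) {\<omega> \<in> ?A. \<omega> (real k * h) = x} = measure (P x) ?A"
  proof (rule measure_eq_AE)
    show "AE \<omega> in P x. (\<omega> \<in> {\<omega> \<in> ?A. \<omega> (real k * h) = x}) = (\<omega> \<in> ?A)"
      using law_start[of x]
    proof eventually_elim
      case (elim \<omega>)
      then show ?case using jump_time_gt_iff[OF _ s(1), of \<omega>] s(1) by blast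
    qed
    have "?A \<inter> {\<omega> \<in> space (P x). \<omega> (real k * h) = x} \<in> sets (P x)"
      using A' by (intro sets.Int) auto
    also have "?A \<inter> {\<omega> \<in> space (P x). \<omega> (real k * h) = x} = {\<omega> \<in> ?A. \<omega> (real k * h) = x}"
      by (auto simp: space_law)
    finally show "{\<omega> \<in> ?A. \<omega> (real k * h) = x} \<in> sets (P x)" .
  qed (rule A')
  also have "measure (P x) ?A = exp (- holding_rate r x * (real k * h))"
    using holding_time[OF s(1), of x] by (simp add: space_law)
  also have "\<dots> = exp (- holding_rate r x * h) ^ k"
    by (simp add: exp_of_nat_mult[symmetric] algebra_simps)
  finally show "measure (P x) (E k) = exp (- holding_rate r x * h) ^ k * trans_prob P h x y" .
qed

text \<open>The paths whose state is \<open>y\<close> at the first jump time rounded up to a multiple of \<open>h\<close>. The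
  rounding makes the Markov property at deterministic times applicable; for paths started at
  \<open>x \<noteq> y\<close>, the probability is a geometric series in the number of the mesh interval.\<close>

definition mesh_jump_to :: "'a \<Rightarrow> real \<Rightarrow> (real \<Rightarrow> 'a) set" where
  "mesh_jump_to y h = (\<Union>k. {\<omega> \<in> cadlag_paths. ereal (real k * h) < jump_time \<omega> \<and>
      \<not> ereal (real (Suc k) * h) < jump_time \<omega> \<and> \<omega> (real (Suc k) * h) = y})"

lemma mesh_jump_to_sets: "y \<noteq> x \<Longrightarrow> 0 \<le> h \<Longrightarrow> mesh_jump_to y h \<in> sets (P x)"
  unfolding mesh_jump_to_def using jump_on_mesh(1) by (intro sets.countable_UN) auto

lemma trans_prob_eq_mesh_jump_to:
  assumes "y \<noteq> x" "0 < h" "0 < holding_rate r x"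
  shows "trans_prob P h x y = (1 - exp (- holding_rate r x * h)) * measure (P x) (mesh_jump_to y h)"
proof -
  interpret prob_space "P x" by (rule law_prob_space)
  let ?E = "\<lambda>k. {\<omega> \<in> cadlag_paths. ereal (real k * h) < jump_time \<omega> \<and>
      \<not> ereal (real (Suc k) * h) < jump_time \<omega> \<and> \<omega> (real (Suc k) * h) = y}"
  have disj: "?E i \<inter> ?E j = {}" if "i < j" for i j
  proof -
    have "real (Suc i) * h \<le> real j * h" using that assms by (intro mult_right_mono) auto
    then have "ereal (real (Suc i) * h) \<le> ereal (real j * h)" by (simp only: ereal_less_eq)
    then have *: "ereal (real (Suc i) * h) < J" if "ereal (real j * h) < J" for J
      using that by (rule le_less_trans)
    show ?thesis
    proof (rule equals0I)
      fix \<omega> assume "\<omega> \<in> ?E i \<inter> ?E j"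
      then show False
        by (elim IntE CollectE conjE) (use * in blast)
    qed
  qed
  have "disjoint_family ?E" by (rule disjoint_family_linorder[OF disj])
  then have "(\<lambda>k. prob (?E k)) sums measure (P x) (mesh_jump_to y h)"
    unfolding mesh_jump_to_def using jump_on_mesh(1)[of y x h] assms
    by (intro finite_measure_UNION) auto
  then have "(\<lambda>k. exp (- holding_rate r x * h) ^ k * trans_prob P h x y) sums
      measure (P x) (mesh_jump_to y h)"
    using jump_on_mesh(2)[of y x h] assms by simp
  moreover have "(\<lambda>k. exp (- holding_rate r x * h) ^ k * trans_prob P h x y) sums
      (1 / (1 - exp (- holding_rate r x * h)) * trans_prob P h x y)"
    using assms by (intro sums_mult2 geometric_sums) auto
  ultimately have "measure (P x) (mesh_jump_to y h) =
      1 / (1 - exp (- holding_rate r x * h)) * trans_prob P h x y"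
    by (rule sums_unique2)
  moreover have "1 - exp (- holding_rate r x * h) \<noteq> 0" using assms by simp
  ultimately show ?thesis by (simp add: field_simps)
qed

text \<open>The rounded jump times converge from above to the jump time, so right continuity makes
  the state at the rounded time eventually equal to the state entered. For a path without jumps both
  sides are false.\<close>

lemma mesh_jump_to_eventually:
  assumes w: "\<omega> \<in> cadlag_paths"
  shows "\<forall>\<^sub>F n in sequentially. \<omega> \<in> mesh_jump_to y (1 / real (Suc n)) \<longleftrightarrow>
    jump_time \<omega> < \<infinity> \<and> \<omega> (real_of_ereal (jump_time \<omega>)) = y"
proof -
  have pos: "0 < jump_time \<omega>"
    using jump_time_gt_iff[OF w, of 0] by (metis order.antisym order_refl zero_ereal_def)
  show ?thesis
  proof (cases "jump_time \<omega>")
    case (real T)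
    have T: "T > 0" using pos real by simp
    \<comment> \<open>The jump time \<open>T\<close> rounded up to a multiple of
      \<open>1 / (n + 1)\<close>.\<close>
    define u where "u n = real (nat \<lceil>T * real (Suc n)\<rceil>) / real (Suc n)" for n
    have u: "T \<le> u n" "u n < T + 1 / real (Suc n)" for n
    proof -
      define m where "m = real (Suc n)"
      have m: "m > 0" by (simp add: m_def)
      have "u n * m = of_int \<lceil>T * m\<rceil>"
        unfolding u_def m_def[symmetric] using T m by simp
      then have "T * m \<le> u n * m" "u n * m < (T + 1 / m) * m"
        using ceiling_correct[of "T * m"] m by (auto simp: algebra_simps)
      then show "T \<le> u n" "u n < T + 1 / real (Suc n)"
        using m unfolding m_def[symmetric] by simp_all
    qed
    have "u \<longlonglongrightarrow> T"
    proof (rule tendsto_sandwich[where f = "\<lambda>_. T" and h = "\<lambda>n. T + 1 / real (Suc n)"])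
      show "(\<lambda>n. T + 1 / real (Suc n)) \<longlonglongrightarrow> T"
        using tendsto_add[OF tendsto_const LIMSEQ_inverse_real_of_nat, of T] by (simp add: inverse_eq_divide)
    qed (use u in \<open>auto intro!: always_eventually less_imp_le\<close>)
    then have "\<forall>\<^sub>F n in sequentially. \<omega> (u n) = \<omega> T"
      using T u by (intro right_limit_approx[OF w]) auto
    moreover have "\<omega> \<in> mesh_jump_to y (1 / real (Suc n)) \<longleftrightarrow> \<omega> (u n) = y" for n
    proof -
      have "(real k * (1 / real (Suc n)) < T \<and> \<not> real (Suc k) * (1 / real (Suc n)) < T) \<longleftrightarrow>
          Suc k = nat \<lceil>T * real (Suc n)\<rceil>" for k
      proof -
        have "(real k * (1 / real (Suc n)) < T \<and> \<not> real (Suc k) * (1 / real (Suc n)) < T) \<longleftrightarrow>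
            \<lceil>T * real (Suc n)\<rceil> = int (Suc k)"
          unfolding ceiling_eq_iff by (auto simp: field_simps)
        also have "\<dots> \<longleftrightarrow> Suc k = nat \<lceil>T * real (Suc n)\<rceil>" by auto
        finally show ?thesis .
      qed
      then have "\<omega> \<in> mesh_jump_to y (1 / real (Suc n)) \<longleftrightarrow>
          (\<exists>k. Suc k = nat \<lceil>T * real (Suc n)\<rceil> \<and> \<omega> (real (Suc k) * (1 / real (Suc n))) = y)"
        using w real unfolding mesh_jump_to_def by auto
      also have "\<dots> \<longleftrightarrow> \<omega> (u n) = y"
      proof -
        \<comment> \<open>The mesh events are indexed by \<open>Suc k\<close>; positivity of
          \<open>T\<close> ensures that the rounded jump time has this form.\<close>
        have "nat \<lceil>T * real (Suc n)\<rceil> > 0" using T by simp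
        then obtain m where "Suc m = nat \<lceil>T * real (Suc n)\<rceil>" by (metis gr0_implies_Suc)
        then show ?thesis unfolding u_def by (metis Suc_inject mult.right_neutral times_divide_eq_right)
      qed
      finally show ?thesis .
    qed
    ultimately show ?thesis using real by (auto elim: eventually_mono)
  next
    case PInf
    then show ?thesis by (auto simp: mesh_jump_to_def)
  next
    case MInf
    then show ?thesis using pos by simp
  qed
qed

text \<open>Indicators of the mesh events converge pointwise to that of the exact event, so
  dominated convergence applies; \<open>jump_law\<close> at time \<open>0\<close> evaluates the
  limit.\<close>

lemma mesh_jump_to_limit:
  assumes "y \<noteq> x"
  shows "(\<lambda>n. measure (P x) (mesh_jump_to y (1 / real (Suc n)))) \<longlonglongrightarrow> r x y / holding_rate r x"
proof -
  interpret prob_space "P x" by (rule law_prob_space)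
  let ?V = "\<lambda>n. mesh_jump_to y (1 / real (Suc n))"
  let ?W = "{\<omega> \<in> cadlag_paths. jump_time \<omega> < \<infinity> \<and> \<omega> (real_of_ereal (jump_time \<omega>)) = y}"
  have V: "?V n \<in> sets (P x)" for n using assms by (intro mesh_jump_to_sets) auto
  have V_cadlag: "?V n \<subseteq> cadlag_paths" for n by (auto simp: mesh_jump_to_def)
  have ev: "\<forall>\<^sub>F n in sequentially. \<omega> \<in> ?V n \<longleftrightarrow> \<omega> \<in> ?W" if "\<omega> \<in> cadlag_paths" for \<omega>
    using mesh_jump_to_eventually[OF that, of y] that by simp
  \<comment> \<open>Writing \<open>?W\<close> as the lower limit of the mesh events yields its
    measurability, without any measurability statement about the state at the jump time.\<close>
  have "?W = (\<Union>N. \<Inter>n\<in>{N..}. ?V n)"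
  proof (intro set_eqI iffI)
    fix \<omega> assume w: "\<omega> \<in> ?W"
    then show "\<omega> \<in> (\<Union>N. \<Inter>n\<in>{N..}. ?V n)"
      using ev[of \<omega>] by (auto simp: eventually_sequentially)
  next
    fix \<omega> assume w: "\<omega> \<in> (\<Union>N. \<Inter>n\<in>{N..}. ?V n)"
    then obtain N where N: "\<And>n. n \<ge> N \<Longrightarrow> \<omega> \<in> ?V n" by auto
    then have "\<omega> \<in> cadlag_paths" using V_cadlag by blast
    from ev[OF this] obtain M where "\<And>n. n \<ge> M \<Longrightarrow> \<omega> \<in> ?V n \<longleftrightarrow> \<omega> \<in> ?W"
      by (auto simp: eventually_sequentially)
    then show "\<omega> \<in> ?W" using N[of "max M N"] by (metis max.cobounded1 max.cobounded2)
  qed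
  also have "\<dots> \<in> sets (P x)" using V by (intro sets.countable_UN sets.countable_INT') auto
  finally have W: "?W \<in> sets (P x)" .
  have "(\<lambda>n. \<integral>\<omega>. indicator (?V n) \<omega> \<partial>P x) \<longlonglongrightarrow> (\<integral>\<omega>. indicator ?W \<omega> \<partial>P x :: real)"
  proof (rule integral_dominated_convergence[where w = "\<lambda>_. 1"])
    show "AE \<omega> in P x. (\<lambda>n. indicator (?V n) \<omega> :: real) \<longlonglongrightarrow> indicator ?W \<omega>"
    proof (rule AE_I2)
      fix \<omega> assume "\<omega> \<in> space (P x)"
      then have "\<forall>\<^sub>F n in sequentially. indicator (?V n) \<omega> = (indicator ?W \<omega> :: real)"
        using ev[of \<omega>] by (auto simp: space_law indicator_def elim: eventually_mono)
      then show "(\<lambda>n. indicator (?V n) \<omega> :: real) \<longlonglongrightarrow> indicator ?W \<omega>"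
        by (rule tendsto_eventually)
    qed
  qed (use V W in \<open>auto intro!: borel_measurable_indicator\<close>)
  then have "(\<lambda>n. prob (?V n)) \<longlonglongrightarrow> prob ?W"
    using V W by simp
  moreover have "?W = {\<omega> \<in> space (P x). ereal 0 < jump_time \<omega> \<and> jump_time \<omega> < \<infinity> \<and>
      \<omega> (real_of_ereal (jump_time \<omega>)) = y}"
    using jump_time_gt_iff[of _ 0] unfolding space_law by (metis order.antisym order_refl)
  ultimately show ?thesis using jump_law[of 0 x y] by simp
qed

text \<open>If the holding rate is positive, the witness is the scaled transition probability
  itself, factored into a difference quotient tending to the holding rate and a mesh probability
  tending to \<open>r x y / holding_rate r x\<close>. At an absorbing state all rates vanish and
  \<open>0\<close> serves.\<close>

lemma trans_prob_rate_ge: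
  assumes "y \<noteq> x"
  obtains w where "w \<longlonglongrightarrow> r x y"
    "\<And>n. w n \<le> real (Suc n) * trans_prob P (1 / real (Suc n)) x y"
proof (cases "holding_rate r x = 0")
  case True
  then show ?thesis by (intro that[of "\<lambda>_. 0"]) (auto simp: rate_eq_0 trans_prob_nonneg)
next
  case False
  then have pos: "holding_rate r x > 0" using holding_rate_nonneg[of x] by simp
  have "(\<lambda>n. (real (Suc n) * (1 - exp (- holding_rate r x / real (Suc n)))) *
      measure (P x) (mesh_jump_to y (1 / real (Suc n)))) \<longlonglongrightarrow>
      holding_rate r x * (r x y / holding_rate r x)"
    by (intro tendsto_mult mult_one_minus_exp_LIMSEQ mesh_jump_to_limit assms)
  then show ?thesis
    using pos trans_prob_eq_mesh_jump_to[OF assms _ pos] by (intro that) auto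
qed

section \<open>The Green function\<close>

text \<open>Joint measurability in path and time, required for Fubini. Rounding time up to a mesh
  leaves countably many coordinates at each level, and right continuity recovers the exact time in
  the limit.\<close>

lemma occupation_measurable:
  "(\<lambda>(\<omega>, t). indicator {y} (\<omega> t) * indicator {0..} t :: ennreal) \<in>
    borel_measurable (P x \<Otimes>\<^sub>M lborel)"
proof -
  define m where "m n t = real_of_int (\<lfloor>t * real (Suc n)\<rfloor> + 1) / real (Suc n)" for n t
  have m: "t \<le> m n t" "m n t \<le> t + 1 / real (Suc n)" for n t
  proof -
    define c where "c = real (Suc n)"
    have c: "c > 0" by (simp add: c_def)
    have "m n t * c = of_int \<lfloor>t * c\<rfloor> + 1"
      unfolding m_def c_def[symmetric] using c by simp
    then have "t * c \<le> m n t * c" "m n t * c \<le> (t + 1 / c) * c"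
      using floor_correct[of "t * c"] c by (auto simp: algebra_simps)
    then show "t \<le> m n t" "m n t \<le> t + 1 / real (Suc n)"
      using c unfolding c_def[symmetric] by simp_all
  qed
  have m_lim: "(\<lambda>n. m n t) \<longlonglongrightarrow> t" for t
  proof (rule tendsto_sandwich[where f = "\<lambda>_. t" and h = "\<lambda>n. t + 1 / real (Suc n)"])
    show "(\<lambda>n. t + 1 / real (Suc n)) \<longlonglongrightarrow> t"
      using tendsto_add[OF tendsto_const LIMSEQ_inverse_real_of_nat, of t] by (simp add: inverse_eq_divide)
  qed (use m in auto)
  have meas: "(\<lambda>(\<omega>, t). indicator {y} (\<omega> (m n t)) * indicator {0..} t :: ennreal) \<in>
      borel_measurable (P x \<Otimes>\<^sub>M lborel)" for n
  proof -
    let ?f = "\<lambda>(k::int) p. indicator {y} (fst p (real_of_int (k + 1) / real (Suc n))) *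
        indicator {0::real..} (snd p) :: ennreal"
    \<comment> \<open>On the strip where the floor equals \<open>k\<close> the rounded time is
      constant, so only a single coordinate map is involved.\<close>
    have "(\<lambda>p. ?f \<lfloor>snd p * real (Suc n)\<rfloor> p) \<in> borel_measurable (P x \<Otimes>\<^sub>M lborel)"
    proof (rule measurable_compose_countable[where f = ?f])
      fix k :: int
      have "(\<lambda>p. fst p (real_of_int (k + 1) / real (Suc n))) \<in>
          measurable (P x \<Otimes>\<^sub>M (lborel :: real measure)) (count_space UNIV)"
        by (rule measurable_compose[OF measurable_fst coordinate_measurable_law])
      then have 1: "(\<lambda>p. indicator {y} (fst p (real_of_int (k + 1) / real (Suc n))) :: ennreal) \<in>
          borel_measurable (P x \<Otimes>\<^sub>M (lborel :: real measure))"
        by (rule measurable_compose) simp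
      have "(indicator {0::real..} :: real \<Rightarrow> ennreal) \<in> borel_measurable lborel"
        by simp
      from measurable_compose[OF measurable_snd this]
      have 2: "(\<lambda>p. indicator {0::real..} (snd p) :: ennreal) \<in> borel_measurable (P x \<Otimes>\<^sub>M (lborel :: real measure))" .
      show "(\<lambda>p. indicator {y} (fst p (real_of_int (k + 1) / real (Suc n))) *
          indicator {0::real..} (snd p) :: ennreal) \<in> borel_measurable (P x \<Otimes>\<^sub>M lborel)"
        by (rule borel_measurable_times_ennreal[OF 1 2])
    qed measurable
    then show ?thesis by (simp add: m_def case_prod_beta)
  qed
  show ?thesis
  proof (rule borel_measurable_LIMSEQ_order)
    fix p :: "(real \<Rightarrow> 'a) \<times> real"
    assume "p \<in> space (P x \<Otimes>\<^sub>M lborel)"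
    then have w: "fst p \<in> cadlag_paths" by (auto simp: space_pair_measure space_law)
    have "\<forall>\<^sub>F n in sequentially. indicator {y} (fst p (m n (snd p))) * indicator {0..} (snd p) =
        (indicator {y} (fst p (snd p)) * indicator {0..} (snd p) :: ennreal)"
    proof (cases "snd p \<ge> 0")
      case True
      from right_limit_approx[OF w True m_lim m(1)] show ?thesis
        by eventually_elim simp
    qed simp
    then show "(\<lambda>n. (\<lambda>(\<omega>, t). indicator {y} (\<omega> (m n t)) * indicator {0..} t :: ennreal) p)
        \<longlonglongrightarrow> (\<lambda>(\<omega>, t). indicator {y} (\<omega> t) * indicator {0..} t) p"
      unfolding case_prod_beta by (rule tendsto_eventually)
  qed (rule meas)
qed

lemma emeasure_coordinate:
  "(\<integral>\<^sup>+\<omega>. indicator {y} (\<omega> t) \<partial>P x) = ennreal (trans_prob P t x y)"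
proof -
  interpret prob_space "P x" by (rule law_prob_space)
  have "(\<integral>\<^sup>+\<omega>. indicator {y} (\<omega> t) \<partial>P x) =
      (\<integral>\<^sup>+\<omega>. indicator {\<omega> \<in> space (P x). \<omega> t = y} \<omega> \<partial>P x)"
    by (intro nn_integral_cong) (auto simp: indicator_def)
  also have "\<dots> = emeasure (P x) {\<omega> \<in> space (P x). \<omega> t = y}"
    by (intro nn_integral_indicator) measurable
  finally show ?thesis by (simp add: emeasure_eq_measure trans_prob_def)
qed

lemma trans_prob_measurable:
  "(\<lambda>t. ennreal (trans_prob P t x y) * indicator {0..} t) \<in> borel_measurable lborel"
proof -
  interpret prob_space "P x" by (rule law_prob_space)
  have "(\<lambda>(t, \<omega>). indicator {y} (\<omega> t) * indicator {0..} t :: ennreal) \<in>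
      borel_measurable (lborel \<Otimes>\<^sub>M P x)"
    using measurable_compose[OF measurable_pair_swap' occupation_measurable[of y x]]
    by (simp add: case_prod_beta)
  then have "(\<lambda>t. \<integral>\<^sup>+\<omega>. indicator {y} (\<omega> t) * indicator {0..} t \<partial>P x) \<in> borel_measurable lborel"
    using borel_measurable_nn_integral[of "\<lambda>t \<omega>. indicator {y} (\<omega> t) * indicator {0..} t" lborel] by simp
  moreover have "(\<integral>\<^sup>+\<omega>. indicator {y} (\<omega> t) * indicator {0..} t \<partial>P x) =
      ennreal (trans_prob P t x y) * indicator {0..} t" for t
    by (subst nn_integral_multc) (auto simp: emeasure_coordinate)
  ultimately show ?thesis by simp
qed

lemma green_eq_integral: "green P x y = (\<integral>\<^sup>+t\<in>{0..}. ennreal (trans_prob P t x y) \<partial>lborel)"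
proof -
  interpret prob_space "P x" by (rule law_prob_space)
  interpret pair_sigma_finite "P x" lborel ..
  have "green P x y = (\<integral>\<^sup>+\<omega>. \<integral>\<^sup>+t. indicator {y} (\<omega> t) * indicator {0..} t \<partial>lborel \<partial>P x)"
    by (simp add: green_def)
  also have "\<dots> = (\<integral>\<^sup>+t. \<integral>\<^sup>+\<omega>. indicator {y} (\<omega> t) * indicator {0..} t \<partial>P x \<partial>lborel)"
    using Fubini'[OF occupation_measurable[of y x]] by simp
  also have "\<dots> = (\<integral>\<^sup>+t. ennreal (trans_prob P t x y) * indicator {0..} t \<partial>lborel)"
    by (intro nn_integral_cong, subst nn_integral_multc) (auto simp: emeasure_coordinate)
  finally show ?thesis .
qed

text \<open>The time integral is cut at \<open>h\<close>. After \<open>h\<close>, Chapman-Kolmogorov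
  restricted to \<open>F\<close> and the substitution of \<open>h + t\<close> for the time produce
  the Green functions started from the states in \<open>F\<close>.\<close>

lemma green_ge_split:
  assumes "finite F" "0 \<le> h"
  shows "(\<integral>\<^sup>+t\<in>{0..<h}. ennreal (trans_prob P t x y) \<partial>lborel) +
    (\<Sum>z\<in>F. ennreal (trans_prob P h x z) * green P z y) \<le> green P x y"
proof -
  let ?p = "\<lambda>t. ennreal (trans_prob P t x y)"
  note meas = trans_prob_measurable
  have "(\<lambda>t. ?p (h + t) * indicator {0..} (h + t)) \<in> borel_measurable lborel"
    by (rule measurable_compose[OF _ meas]) simp
  have eq1: "?p t * indicator {0..<h} t = (?p t * indicator {0..} t) * indicator {0..<h} t"
    and eq2: "?p t * indicator {h..} t = (?p t * indicator {0..} t) * indicator {h..} t" for t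
    using assms by (auto simp: indicator_def)
  have "(\<Sum>z\<in>F. ennreal (trans_prob P h x z) * green P z y) =
      (\<Sum>z\<in>F. \<integral>\<^sup>+t. ennreal (trans_prob P h x z) * (ennreal (trans_prob P t z y) * indicator {0..} t) \<partial>lborel)"
    unfolding green_eq_integral using meas by (intro sum.cong refl nn_integral_cmult[symmetric])
  also have "\<dots> = (\<integral>\<^sup>+t. (\<Sum>z\<in>F. ennreal (trans_prob P h x z) * (ennreal (trans_prob P t z y) * indicator {0..} t)) \<partial>lborel)"
    using meas by (intro nn_integral_sum[symmetric] borel_measurable_times_ennreal[OF borel_measurable_const])
  also have "\<dots> \<le> (\<integral>\<^sup>+t. ?p (h + t) * indicator {h..} (h + t) \<partial>lborel)"
  proof (intro nn_integral_mono)
    fix t :: real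
    show "(\<Sum>z\<in>F. ennreal (trans_prob P h x z) * (ennreal (trans_prob P t z y) * indicator {0..} t))
        \<le> ?p (h + t) * indicator {h..} (h + t)"
    proof (cases "0 \<le> t")
      case True
      then have "(\<Sum>z\<in>F. ennreal (trans_prob P h x z) * (ennreal (trans_prob P t z y) * indicator {0..} t)) =
          ennreal (\<Sum>z\<in>F. trans_prob P h x z * trans_prob P t z y)"
        by (simp add: ennreal_mult trans_prob_nonneg flip: sum_ennreal)
      also have "\<dots> \<le> ?p (h + t)"
        using True assms by (intro ennreal_leI trans_prob_add_ge)
      finally show ?thesis using True by simp
    qed simp
  qed
  also have "\<dots> = (\<integral>\<^sup>+t. ?p t * indicator {h..} t \<partial>lborel)"
    using nn_integral_real_affine[of "\<lambda>t. ?p t * indicator {h..} t" 1 h] meas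
    by (simp add: eq2)
  finally have "(\<integral>\<^sup>+t\<in>{0..<h}. ?p t \<partial>lborel) + (\<Sum>z\<in>F. ennreal (trans_prob P h x z) * green P z y) \<le>
      (\<integral>\<^sup>+t\<in>{0..<h}. ?p t \<partial>lborel) + (\<integral>\<^sup>+t\<in>{h..}. ?p t \<partial>lborel)"
    by (rule add_left_mono)
  also have "\<dots> = (\<integral>\<^sup>+t. ?p t * indicator {0..<h} t + ?p t * indicator {h..} t \<partial>lborel)"
    unfolding eq1 eq2
    by (intro nn_integral_add[symmetric] borel_measurable_times_ennreal[OF meas]) simp_all
  also have "\<dots> = green P x y"
    unfolding green_eq_integral using assms by (intro nn_integral_cong) (auto simp: indicator_def)
  finally show ?thesis .
qed

section \<open>Finiteness of the Green function under transience\<close>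

text \<open>Decomposition according to the last visit to \<open>x\<close> at an integer time.\<close>

lemma sums_last_visit:
  assumes "transient_process P"
  shows "(\<lambda>k. trans_prob P (real k) x x *
    measure (P x) {\<omega> \<in> space (P x). \<forall>j. \<omega> (real (Suc j)) \<noteq> x}) sums 1"
proof -
  interpret prob_space "P x" by (rule law_prob_space)
  let ?E = "\<lambda>k. {\<omega> \<in> space (P x). \<omega> (real k) = x \<and> (\<forall>j. \<omega> (real k + real (Suc j)) \<noteq> x)}"
  let ?B = "{\<omega> \<in> cadlag_paths. \<forall>j. \<omega> (real (Suc j)) \<noteq> x}"
  have E: "?E k \<in> sets (P x)" for k by measurable
  have "{\<omega> \<in> space (P x). \<forall>j. \<omega> (real (Suc j)) \<noteq> x} \<in> sets (P x)" by measurable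
  then have "?B \<in> sets path_space" by (simp only: space_law law_sets)
  have prob_E: "prob (?E k) = trans_prob P (real k) x x * prob {\<omega> \<in> space (P x). \<forall>j. \<omega> (real (Suc j)) \<noteq> x}" for k
  proof -
    have "?E k = {\<omega> \<in> cadlag_paths. \<omega> (real k) = x \<and> shift (real k) \<omega> \<in> ?B}"
      by (auto simp: space_law shift_apply intro: cadlag_shift)
    then show ?thesis
      using markov_property[OF _ cadlag_in_past \<open>?B \<in> sets path_space\<close>, of "real k" x x]
      by (simp add: trans_prob_def space_law)
  qed
  have disj: "?E i \<inter> ?E j = {}" if "i < j" for i j
  proof -
    \<comment> \<open>A visit at time \<open>j\<close> is the return excluded by \<open>?E i\<close>
      at its index \<open>j - i - 1\<close>.\<close>
    have "real j = real i + real (Suc (j - i - 1))" using that by simp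
    then show ?thesis by (metis (mono_tags, lifting) Int_iff equals0I mem_Collect_eq)
  qed
  have "disjoint_family ?E" by (rule disjoint_family_linorder[OF disj])
  then have "(\<lambda>k. prob (?E k)) sums prob (\<Union>k. ?E k)"
    using E by (intro finite_measure_UNION) auto
  moreover have "prob (\<Union>k. ?E k) = 1"
  proof (rule prob_eq_1[THEN iffD2])
    show "(\<Union>k. ?E k) \<in> events" using E by (intro sets.countable_UN) auto
    have "AE \<omega> in P x. bounded {t. 0 \<le> t \<and> \<omega> t = x}"
      using assms by (simp add: transient_process_def)
    then show "AE \<omega> in P x. \<omega> \<in> (\<Union>k. ?E k)"
      using law_start[of x] AE_space
    proof eventually_elim
      case (elim \<omega>)
      let ?K = "{k. \<omega> (real k) = x}"
      obtain b where b: "\<And>t. 0 \<le> t \<Longrightarrow> \<omega> t = x \<Longrightarrow> \<bar>t\<bar> \<le> b"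
        using elim(1) by (auto simp: bounded_iff)
      \<comment> \<open>Transience bounds the visit times, so only finitely many integer visits
        occur; time \<open>0\<close> is one of them, and the maximum is the last visit.\<close>
      have "?K \<subseteq> {..nat \<lceil>b\<rceil>}"
      proof
        fix k assume "k \<in> ?K"
        then have "real k \<le> b" using b[of "real k"] by simp
        then show "k \<in> {..nat \<lceil>b\<rceil>}" by (simp add: le_nat_iff) linarith
      qed
      then have fin: "finite ?K" by (rule finite_subset) simp
      moreover have "0 \<in> ?K" using elim(2) by simp
      ultimately have "Max ?K \<in> ?K" by (intro Max_in) blast+
      moreover have "\<omega> (real (Max ?K) + real (Suc j)) \<noteq> x" for j
      proof
        assume "\<omega> (real (Max ?K) + real (Suc j)) = x"
        then have "Max ?K + Suc j \<in> ?K" by (simp only: mem_Collect_eq of_nat_add)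
        with Max_ge[OF fin this] show False by simp
      qed
      ultimately show ?case using elim(3) by blast
    qed
  qed
  ultimately show ?thesis by (simp only: prob_E)
qed

text \<open>The no-return probability is nonzero, since otherwise the last-visit series would sum to
  \<open>0\<close>. Hence the return probabilities at integer times are summable, and the integral
  over each unit interval is dominated by the value at its right endpoint.\<close>

lemma green_finite_same:
  assumes "transient_process P"
  shows "green P x x < \<infinity>"
proof -
  let ?l = "holding_rate r x"
  let ?q = "measure (P x) {\<omega> \<in> space (P x). \<forall>j. \<omega> (real (Suc j)) \<noteq> x}"
  note last = sums_last_visit[OF assms, of x]
  have "?q \<noteq> 0"
  proof
    assume "?q = 0"
    with last have "(\<lambda>k. 0::real) sums 1" by simp
    then show False using sums_unique2[OF sums_zero] by force
  qed
  with last have "summable (\<lambda>k. trans_prob P (real k) x x)"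
    using summable_mult2[OF sums_summable[OF last], of "inverse ?q"] by (simp add: mult.assoc)
  then have "summable (\<lambda>k. trans_prob P (real (Suc k)) x x)"
    by (subst summable_Suc_iff)
  then have sm: "summable (\<lambda>k. exp ?l * trans_prob P (real (Suc k)) x x)"
    by (rule summable_mult)
  let ?c = "\<lambda>k. exp ?l * trans_prob P (real (Suc k)) x x"
  \<comment> \<open>From time \<open>t\<close> the path can simply wait at \<open>x\<close> until
    the next integer; the wait is at most one time unit, which costs at most the factor
    \<open>exp (- ?l)\<close>.\<close>
  have le: "trans_prob P t x x \<le> ?c k" if "real k \<le> t" "t < real (Suc k)" for t k
  proof -
    have "trans_prob P t x x * exp (- ?l) \<le> trans_prob P t x x * trans_prob P (real (Suc k) - t) x x"
    proof (rule mult_left_mono[OF _ trans_prob_nonneg])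
      have "?l * (real (Suc k) - t) \<le> ?l * 1"
        using that by (intro mult_left_mono holding_rate_nonneg) auto
      then have "exp (- ?l) \<le> exp (- ?l * (real (Suc k) - t))" by simp
      also have "\<dots> \<le> trans_prob P (real (Suc k) - t) x x"
        using that by (intro trans_prob_same_ge) auto
      finally show "exp (- ?l) \<le> trans_prob P (real (Suc k) - t) x x" .
    qed
    also have "\<dots> \<le> trans_prob P (real (Suc k)) x x"
      using trans_prob_add_ge[of "{x}" t "real (Suc k) - t" x x] that by simp
    finally show ?thesis by (simp add: exp_minus field_simps)
  qed
  have "green P x x \<le> (\<integral>\<^sup>+t. (\<Sum>k. ennreal (?c k) * indicator {real k..<real (Suc k)} t) \<partial>lborel)"
    unfolding green_eq_integral
  proof (intro nn_integral_mono)
    fix t :: real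
    show "ennreal (trans_prob P t x x) * indicator {0..} t \<le>
        (\<Sum>k. ennreal (?c k) * indicator {real k..<real (Suc k)} t)"
    proof (cases "0 \<le> t")
      case True
      define k where "k = nat \<lfloor>t\<rfloor>"
      have k: "real k \<le> t" "t < real (Suc k)" using True unfolding k_def by (simp_all, linarith)
      then have "ennreal (trans_prob P t x x) * indicator {0..} t \<le>
          ennreal (?c k) * indicator {real k..<real (Suc k)} t"
        using True le[OF k] by (simp add: ennreal_leI)
      also have "\<dots> \<le> (\<Sum>k. ennreal (?c k) * indicator {real k..<real (Suc k)} t)"
        using sum_le_suminf[OF summableI, of "{k}" "\<lambda>k. ennreal (?c k) * indicator {real k..<real (Suc k)} t"]
        by (simp only: sum.insert sum.empty finite.emptyI empty_iff not_False_eq_True add_0_right finite.insertI zero_le)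
      finally show ?thesis .
    qed simp
  qed
  also have "\<dots> = (\<Sum>k. \<integral>\<^sup>+t. ennreal (?c k) * indicator {real k..<real (Suc k)} t \<partial>lborel)"
    by (intro nn_integral_suminf) auto
  also have "\<dots> = (\<Sum>k. ennreal (?c k))"
    by (simp add: nn_integral_cmult_indicator)
  also have "\<dots> = ennreal (\<Sum>k. ?c k)"
    using sm by (intro suminf_ennreal2) (auto simp: trans_prob_nonneg)
  also have "\<dots> < \<infinity>" by simp
  finally show ?thesis .
qed

text \<open>Irreducibility lets the process started at \<open>y\<close> reach \<open>x\<close> with
  positive probability, so a multiple of \<open>green P x y\<close> is bounded by
  \<open>green P y y\<close>.\<close>

lemma green_finite:
  assumes "transient_process P" "irreducible_process P"
  shows "green P x y < \<infinity>"
proof -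
  obtain t where t: "t \<ge> 0" "trans_prob P t y x > 0"
    using assms(2) unfolding irreducible_process_def trans_prob_def by blast
  have "ennreal (trans_prob P t y x) * green P x y \<le> green P y y"
    using green_ge_split[of "{x}" t y y] t(1) by (auto intro: order_trans[rotated])
  also have "\<dots> < \<infinity>" by (rule green_finite_same[OF assms(1)])
  finally show ?thesis using t(2) by (auto simp: ennreal_mult_less_top less_top)
qed

text \<open>Superharmonicity of the Green function in its first argument, with a unit source at
  \<open>y\<close>. It supplies the upper barrier for \<open>killed_green_exists\<close>.\<close>

lemma green_first_step:
  assumes fin: "\<And>z. green P z y < \<infinity>" and F: "finite F"
  shows "(if x = y then 1 else 0) + (\<Sum>z\<in>F. r x z * enn2real (green P z y)) \<le>
    holding_rate r x * enn2real (green P x y)"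
proof -
  let ?l = "holding_rate r x"
  define g where "g z = enn2real (green P z y)" for z
  let ?h = "\<lambda>n. 1 / real (Suc n)"
  let ?F = "F - {x}"
  have g_nonneg: "0 \<le> g z" for z by (simp add: g_def)
  have green: "green P z y = ennreal (g z)" for z using fin[of z] by (simp add: g_def less_top)
  have "\<forall>z\<in>?F. \<exists>w. w \<longlonglongrightarrow> r x z \<and> (\<forall>n. w n \<le> real (Suc n) * trans_prob P (?h n) x z)"
    using trans_prob_rate_ge by (metis DiffD2 singletonI)
  then obtain w where w: "\<And>z. z \<in> ?F \<Longrightarrow> w z \<longlonglongrightarrow> r x z"
    "\<And>z n. z \<in> ?F \<Longrightarrow> w z n \<le> real (Suc n) * trans_prob P (?h n) x z"
    by metis
  \<comment> \<open>A lower bound for \<open>trans_prob P t x y\<close> throughout the interval from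
    \<open>0\<close> to \<open>1 / (n + 1)\<close>: if \<open>x = y\<close>, the probability of not
    jumping during the whole interval.\<close>
  define e where "e n = (if x = y then exp (- ?l / real (Suc n)) else 0)" for n
  have step: "e n + (\<Sum>z\<in>?F. w z n * g z) \<le>
      real (Suc n) * (1 - exp (- ?l / real (Suc n))) * g x" for n
  proof -
    have h: "0 < ?h n" by simp
    have nn: "0 \<le> trans_prob P (?h n) x z * g z" for z
      by (intro mult_nonneg_nonneg trans_prob_nonneg g_nonneg)
    have "ennreal (e n * ?h n) \<le> (\<integral>\<^sup>+t\<in>{0..<?h n}. ennreal (trans_prob P t x y) \<partial>lborel)"
    proof -
      have "ennreal (e n * ?h n) = (\<integral>\<^sup>+t. ennreal (e n) * indicator {0..<?h n} t \<partial>lborel)"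
        by (subst nn_integral_cmult_indicator) (auto simp: e_def simp flip: ennreal_mult)
      also have "\<dots> \<le> (\<integral>\<^sup>+t\<in>{0..<?h n}. ennreal (trans_prob P t x y) \<partial>lborel)"
      proof (intro nn_integral_mono)
        fix t :: real
        have "e n \<le> trans_prob P t x y" if "0 \<le> t" "t < ?h n"
        proof (cases "x = y")
          case True
          have "?l * t \<le> ?l * ?h n" using that by (intro mult_left_mono holding_rate_nonneg) auto
          then have "e n \<le> exp (- ?l * t)" using True by (simp add: e_def)
          also have "\<dots> \<le> trans_prob P t x y" using trans_prob_same_ge that True by simp
          finally show ?thesis .
        qed (simp add: e_def trans_prob_nonneg)
        then show "ennreal (e n) * indicator {0..<?h n} t \<le>
            ennreal (trans_prob P t x y) * indicator {0..<?h n} t"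
          by (auto simp: indicator_def intro: ennreal_leI)
      qed
      finally show ?thesis .
    qed
    then have "ennreal (e n * ?h n) + (\<Sum>z\<in>insert x ?F. ennreal (trans_prob P (?h n) x z) * green P z y)
        \<le> green P x y"
      using green_ge_split[of "insert x ?F" "?h n" x y] F h
      by (meson add_right_mono finite_Diff finite_insert less_imp_le order_trans)
    moreover have "(\<Sum>z\<in>insert x ?F. ennreal (trans_prob P (?h n) x z) * green P z y) =
        ennreal (\<Sum>z\<in>insert x ?F. trans_prob P (?h n) x z * g z)"
      unfolding green
      by (simp only: ennreal_mult trans_prob_nonneg g_nonneg sum_ennreal[OF nn, symmetric])
    moreover have "0 \<le> e n" "0 \<le> (\<Sum>z\<in>insert x ?F. trans_prob P (?h n) x z * g z)"
      using nn by (simp add: e_def, intro sum_nonneg)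
    ultimately have "e n * ?h n + (\<Sum>z\<in>insert x ?F. trans_prob P (?h n) x z * g z) \<le> g x"
      unfolding green using g_nonneg h
      by (simp add: ennreal_plus[symmetric] ennreal_le_iff del: ennreal_plus sum.insert_remove)
    \<comment> \<open>The diagonal term moves to the right, where
      \<open>1 - trans_prob P (?h n) x x\<close> is at most the probability of a jump before
      \<open>?h n\<close> and scales to the holding rate.\<close>
    then have "e n * ?h n + (\<Sum>z\<in>?F. trans_prob P (?h n) x z * g z) \<le>
        (1 - trans_prob P (?h n) x x) * g x"
      using F sum.insert[of ?F x "\<lambda>z. trans_prob P (?h n) x z * g z"]
      by (simp only: finite_Diff Diff_iff insert_iff simp_thms) (simp add: algebra_simps)
    also have "\<dots> \<le> (1 - exp (- ?l * ?h n)) * g x"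
      using trans_prob_same_ge[of "?h n" x] h g_nonneg by (intro mult_right_mono) auto
    finally have "real (Suc n) * (e n * ?h n + (\<Sum>z\<in>?F. trans_prob P (?h n) x z * g z)) \<le>
        real (Suc n) * ((1 - exp (- ?l * ?h n)) * g x)"
      by (intro mult_left_mono) auto
    then have "e n + (\<Sum>z\<in>?F. real (Suc n) * trans_prob P (?h n) x z * g z) \<le>
        real (Suc n) * (1 - exp (- ?l / real (Suc n))) * g x"
      by (simp add: distrib_left sum_distrib_left mult.assoc del: of_nat_Suc)
    moreover have "(\<Sum>z\<in>?F. w z n * g z) \<le> (\<Sum>z\<in>?F. real (Suc n) * trans_prob P (?h n) x z * g z)"
      using w(2) g_nonneg by (intro sum_mono mult_right_mono) auto
    ultimately show ?thesis by linarith
  qed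
  have "(\<lambda>n. exp (- ?l / real (Suc n))) \<longlonglongrightarrow> exp 0"
    using tendsto_mult[OF tendsto_const LIMSEQ_inverse_real_of_nat, of "- ?l"]
    by (intro tendsto_exp) (simp add: divide_inverse)
  then have "e \<longlonglongrightarrow> (if x = y then 1 else 0)"
    unfolding e_def by auto
  moreover have "(\<lambda>n. \<Sum>z\<in>?F. w z n * g z) \<longlonglongrightarrow> (\<Sum>z\<in>?F. r x z * g z)"
    by (intro tendsto_sum tendsto_mult w tendsto_const)
  ultimately have "(if x = y then 1 else 0) + (\<Sum>z\<in>?F. r x z * g z) \<le> ?l * g x"
    using step
    by (intro LIMSEQ_le[OF tendsto_add tendsto_mult[OF mult_one_minus_exp_LIMSEQ tendsto_const]]) auto
  \<comment> \<open>The state \<open>x\<close> can be put back into the sum because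
    \<open>r x x = 0\<close>.\<close>
  moreover have "(\<Sum>z\<in>?F. r x z * g z) = (\<Sum>z\<in>F. r x z * g z)"
    using F by (intro sum.mono_neutral_left) (auto simp: rate_diag)
  ultimately show ?thesis by (simp add: g_def)
qed

end

section \<open>The variational formula\<close>

text \<open>The total rate enters as a parameter \<open>c\<close> so that the same formula serves
  both \<open>r\<close> and \<open>adj_rate \<mu> r\<close>.\<close>

lemma gen_finite_support:
  assumes "finite B" "H \<in> vanishing_off B" "(q x has_sum c) UNIV"
  shows "gen q H x = (\<Sum>y\<in>B. q x y * H y) - c * H x"
proof -
  have "((\<lambda>y. q x y * H y) has_sum (\<Sum>y\<in>B. q x y * H y)) UNIV"
    using assms(1,2) by (intro has_sum_finite_neutralI) (auto simp: vanishing_off_def)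
  moreover have "((\<lambda>y. q x y * H x) has_sum c * H x) UNIV"
    using assms(3) by (rule has_sum_cmult_left)
  ultimately have "((\<lambda>y. q x y * H y + - (q x y * H x)) has_sum
      ((\<Sum>y\<in>B. q x y * H y) + - (c * H x))) UNIV"
    by (intro has_sum_add has_sum_uminusI)
  then show ?thesis
    unfolding gen_def by (intro infsumI) (simp add: right_diff_distrib)
qed

lemma inner_mu_finite_support:
  assumes "finite B" "H \<in> vanishing_off B \<or> K \<in> vanishing_off B"
  shows "inner_mu \<mu> H K = (\<Sum>x\<in>B. \<mu> x * H x * K x)"
  unfolding inner_mu_def using assms
  by (intro infsumI has_sum_finite_neutralI) (auto simp: vanishing_off_def)

section \<open>Summation by parts and the killed Green function\<close>

context jump_rates
begin

lemma has_sum_holding_rate: "(r x has_sum holding_rate r x) UNIV"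
  unfolding holding_rate_def by (intro has_sum_infsum rate_summable)

text \<open>Stationarity of \<open>\<mu>\<close>, divided by \<open>\<mu> x\<close>: the adjoint
  process has the same holding rates.\<close>

lemma has_sum_adj_rate:
  assumes "stationary_measure r \<mu>"
  shows "(adj_rate \<mu> r x has_sum holding_rate r x) UNIV"
proof -
  have pos: "\<mu> x > 0" using assms by (simp add: stationary_measure_def)
  have "((\<lambda>y. \<mu> y * r y x / \<mu> x) has_sum (\<mu> x * holding_rate r x / \<mu> x)) UNIV"
    using assms by (intro has_sum_divide_const) (simp add: stationary_measure_def)
  then show ?thesis using pos by (simp add: adj_rate_def[abs_def])
qed

text \<open>Both pairings reduce to finite sums over \<open>B\<close>. The off-diagonal parts agree
  after exchanging the sums, and the diagonal parts agree because the holding rates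
  coincide.\<close>

lemma inner_mu_adj_gen:
  assumes "stationary_measure r \<mu>" "finite B" "f \<in> vanishing_off B" "H \<in> vanishing_off B"
  shows "inner_mu \<mu> (adj_gen \<mu> r f) H = inner_mu \<mu> f (gen r H)"
proof -
  have pos: "\<mu> x \<noteq> 0" for x using assms(1) by (metis less_irrefl stationary_measure_def)
  have "inner_mu \<mu> (adj_gen \<mu> r f) H =
      (\<Sum>x\<in>B. \<mu> x * ((\<Sum>y\<in>B. adj_rate \<mu> r x y * f y) - holding_rate r x * f x) * H x)"
    using assms
    by (simp add: inner_mu_finite_support[where B = B] adj_gen_def
        gen_finite_support[OF assms(2,3) has_sum_adj_rate[OF assms(1)]])
  also have "\<dots> = (\<Sum>x\<in>B. (\<Sum>y\<in>B. \<mu> y * f y * r y x * H x) - \<mu> x * holding_rate r x * f x * H x)"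
    using pos by (simp add: adj_rate_def left_diff_distrib right_diff_distrib sum_distrib_left
        sum_distrib_right mult_ac)
  also have "\<dots> = (\<Sum>y\<in>B. (\<Sum>x\<in>B. \<mu> y * f y * r y x * H x)) - (\<Sum>x\<in>B. \<mu> x * holding_rate r x * f x * H x)"
    unfolding sum_subtractf by (subst sum.swap) simp
  also have "\<dots> = (\<Sum>y\<in>B. \<mu> y * f y * ((\<Sum>x\<in>B. r y x * H x) - holding_rate r y * H y))"
    by (simp add: right_diff_distrib sum_distrib_left sum_subtractf mult_ac)
  also have "\<dots> = inner_mu \<mu> f (gen r H)"
    using assms
    by (simp add: inner_mu_finite_support[where B = B]
        gen_finite_support[OF assms(2,4) has_sum_holding_rate])
  finally show ?thesis .
qed

text \<open>By duality both halves of \<open>sym_gen\<close> contribute equally to the quadratic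
  form, so the non-reversible generator can be used in its place.\<close>

lemma inner_mu_sym_gen:
  assumes "stationary_measure r \<mu>" "finite B" "H \<in> vanishing_off B"
  shows "inner_mu \<mu> H (\<lambda>y. - sym_gen \<mu> r H y) = - inner_mu \<mu> H (gen r H)"
proof -
  have "inner_mu \<mu> H (\<lambda>y. - sym_gen \<mu> r H y) =
      - (inner_mu \<mu> H (gen r H) + inner_mu \<mu> H (adj_gen \<mu> r H)) / 2"
    unfolding inner_mu_finite_support[OF assms(2) disjI1[OF assms(3)]] sym_gen_def
      sum.distrib[symmetric] sum_negf[symmetric] sum_divide_distrib
    by (intro sum.cong) (simp_all add: field_simps)
  also have "inner_mu \<mu> H (adj_gen \<mu> r H) = inner_mu \<mu> (adj_gen \<mu> r H) H"
    by (simp add: inner_mu_def mult_ac)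
  also have "\<dots> = inner_mu \<mu> H (gen r H)"
    by (rule inner_mu_adj_gen[OF assms assms(3)])
  finally show ?thesis by simp
qed

text \<open>The Green function of the process killed on leaving \<open>B\<close>, obtained by monotone iteration
  below the superharmonic function \<open>g\<close>.\<close>

lemma killed_green_exists:
  assumes "finite B" "x \<in> B" and g0: "\<And>y. 0 \<le> g y"
    and super: "\<And>y. (if y = x then 1 else 0) + (\<Sum>z\<in>B. r y z * g z) \<le> holding_rate r y * g y"
  obtains H where "H \<in> vanishing_off B" "0 < H x" "H x \<le> g x"
    "\<forall>y\<in>B. gen r H y = (if y = x then -1 else 0)"
proof -
  let ?l = "holding_rate r"
  \<comment> \<open>The equation \<open>gen r h y = - 1\<close> at \<open>x\<close> and
    \<open>0\<close> elsewhere on \<open>B\<close>, solved for the diagonal term. At an absorbing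
    state, division by zero gives the value \<open>0\<close>.\<close>
  define step where "step h y =
      (if y \<in> B then ((if y = x then 1 else 0) + (\<Sum>z\<in>B. r y z * h z)) / ?l y else 0)"
    for h and y
  define H where "H n = (step ^^ n) (\<lambda>_. 0)" for n
  have H_Suc: "H (Suc n) y = step (H n) y" for n y by (simp add: H_def)
  note l0 = holding_rate_nonneg
  have step_mono: "step h y \<le> step k y" if "\<And>z. h z \<le> k z" for h k y
    unfolding step_def using that l0
    by (auto intro!: divide_right_mono add_left_mono sum_mono mult_left_mono rate_nonneg)
  have step_nonneg: "0 \<le> step h y" if "\<And>z. 0 \<le> h z" for h y
    unfolding step_def using that l0 by (auto intro!: divide_nonneg_nonneg add_nonneg_nonneg sum_nonneg mult_nonneg_nonneg rate_nonneg)
  have step_g: "step g y \<le> g y" for y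
  proof (cases "y \<in> B \<and> ?l y > 0")
    case True
    then show ?thesis using super[of y] by (simp add: step_def divide_simps mult.commute)
  next
    case False
    then have "step g y = 0" using l0[of y] by (auto simp: step_def)
    then show ?thesis using g0 by simp
  qed
  have H_nonneg: "0 \<le> H n y" for n y
  proof (induction n arbitrary: y)
    case 0
    then show ?case by (simp add: H_def)
  next
    case (Suc n)
    then show ?case unfolding H_Suc by (rule step_nonneg)
  qed
  have H_incseq: "H n y \<le> H (Suc n) y" for n y
  proof (induction n arbitrary: y)
    case 0
    have "H 0 y = 0" by (simp add: H_def)
    with H_nonneg[of "Suc 0" y] show ?case by simp
  next
    case (Suc n)
    then show ?case by (subst (1 2) H_Suc) (rule step_mono)
  qed
  have H_le: "H n y \<le> g y" for n y
  proof (induction n arbitrary: y)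
    case 0
    then show ?case using g0 by (simp add: H_def)
  next
    case (Suc n)
    then show ?case by (subst H_Suc) (rule order_trans[OF step_mono step_g])
  qed
  \<comment> \<open>The iterates increase and stay below \<open>g\<close>, so this real supremum is
    their limit.\<close>
  define K where "K y = (SUP n. H n y)" for y
  have lim: "(\<lambda>n. H n y) \<longlonglongrightarrow> K y" for y
    unfolding K_def using H_incseq H_le
    by (intro LIMSEQ_incseq_SUP bdd_aboveI2[where M = "g y"]) (auto simp: incseq_Suc_iff)
  have K: "K y = step K y" for y
  proof (rule LIMSEQ_unique)
    show "(\<lambda>n. H (Suc n) y) \<longlonglongrightarrow> K y" by (rule LIMSEQ_Suc[OF lim])
    show "(\<lambda>n. H (Suc n) y) \<longlonglongrightarrow> step K y"
      unfolding H_Suc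
    proof (cases "y \<in> B")
      case True
      have "(\<lambda>n. inverse (?l y) * ((if y = x then 1 else 0) + (\<Sum>z\<in>B. r y z * H n z))) \<longlonglongrightarrow>
          inverse (?l y) * ((if y = x then 1 else 0) + (\<Sum>z\<in>B. r y z * K z))"
        by (intro tendsto_intros lim)
      then show "(\<lambda>n. step (H n) y) \<longlonglongrightarrow> step K y"
        using True by (simp add: step_def divide_inverse mult.commute)
    qed (simp add: step_def)
  qed
  have K_nonneg: "0 \<le> K y" for y
    using lim[of y] H_nonneg by (intro LIMSEQ_le_const) auto
  have K_le: "K y \<le> g y" for y
    using lim[of y] H_le by (intro LIMSEQ_le_const2) auto
  have rg: "0 \<le> (\<Sum>z\<in>B. r y z * g z)" for y
    by (intro sum_nonneg mult_nonneg_nonneg rate_nonneg g0)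
  \<comment> \<open>A zero holding rate at \<open>x\<close> would turn \<open>super\<close> at
    \<open>x\<close> into \<open>1 + ... \<le> 0\<close>.\<close>
  have "0 < ?l x"
    using super[of x] rg[of x] l0[of x] by (cases "?l x = 0") auto
  have van: "K \<in> vanishing_off B"
    using K by (auto simp: vanishing_off_def step_def)
  show ?thesis
  proof
    show "K \<in> vanishing_off B" by (rule van)
    have "0 < step K x"
      using \<open>0 < ?l x\<close> assms(2) K_nonneg unfolding step_def
      by (auto intro!: divide_pos_pos add_pos_nonneg sum_nonneg mult_nonneg_nonneg rate_nonneg)
    then show "0 < K x" by (subst K)
    show "K x \<le> g x" by (rule K_le)
    show "\<forall>y\<in>B. gen r K y = (if y = x then -1 else 0)"
    proof
      fix y assume y: "y \<in> B"
      have "?l y * K y = (if y = x then 1 else 0) + (\<Sum>z\<in>B. r y z * K z)"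
      proof (cases "?l y = 0")
        \<comment> \<open>Here \<open>y\<close> differs from \<open>x\<close>, whose holding rate is
          positive, so both sides vanish.\<close>
        case True
        then have "r y z = 0" for z by (rule rate_eq_0)
        then show ?thesis using True \<open>0 < ?l x\<close> by auto
      next
        case False
        then show ?thesis using y by (subst K) (simp add: step_def)
      qed
      then show "gen r K y = (if y = x then -1 else 0)"
        using gen_finite_support[where q = r and x = y, OF assms(1) van has_sum_holding_rate] by auto
    qed
  qed
qed

text \<open>The factor \<open>- f x / H x\<close> maximizes the quadratic functional along the line spanned by \<open>H\<close>.\<close>

lemma variational_lower_bound:
  assumes "stationary_measure r \<mu>" "finite B" "f \<in> vanishing_off B" "x \<in> B"
    and H: "H \<in> vanishing_off B" "0 < H x"
      "\<forall>y\<in>B. gen r H y = (if y = x then -1 else 0)"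
  defines "K \<equiv> \<lambda>y. - f x / H x * H y"
  shows "K \<in> vanishing_off B"
    "2 * inner_mu \<mu> (adj_gen \<mu> r f) K - inner_mu \<mu> K (\<lambda>y. - sym_gen \<mu> r K y) =
      \<mu> x * (f x)\<^sup>2 / H x"
proof -
  show K: "K \<in> vanishing_off B" using H(1) by (auto simp: K_def vanishing_off_def)
  have gen_K: "gen r K y = - f x / H x * gen r H y" for y
    unfolding gen_finite_support[OF assms(2) K has_sum_holding_rate]
      gen_finite_support[OF assms(2) H(1) has_sum_holding_rate]
    by (simp add: K_def right_diff_distrib sum_distrib_left mult_ac)
  \<comment> \<open>On \<open>B\<close> the function \<open>gen r K\<close> lives only at
    \<open>x\<close>, with value \<open>f x / H x\<close>. The pairing is used for
    \<open>h = f\<close> and for \<open>h = K\<close>, where \<open>K x = - f x\<close>.\<close>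
  have inner: "inner_mu \<mu> h (gen r K) = \<mu> x * h x * (f x / H x)" if "h \<in> vanishing_off B" for h
  proof -
    have "inner_mu \<mu> h (gen r K) = (\<Sum>y\<in>B. if y = x then \<mu> x * h x * (f x / H x) else 0)"
      unfolding inner_mu_finite_support[OF assms(2) disjI1[OF that]]
      by (intro sum.cong) (simp_all add: gen_K H(3))
    then show ?thesis using assms(2,4) by simp
  qed
  show "2 * inner_mu \<mu> (adj_gen \<mu> r f) K - inner_mu \<mu> K (\<lambda>y. - sym_gen \<mu> r K y) =
      \<mu> x * (f x)\<^sup>2 / H x"
    unfolding inner_mu_adj_gen[OF assms(1-3) K] inner_mu_sym_gen[OF assms(1,2) K]
      inner[OF assms(3)] inner[OF K]
    using H(2) by (simp add: K_def power2_eq_square field_simps)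
qed

end

text \<open>Monotonicity is assumed only from index \<open>1\<close> on, so the sequence is shifted
  by one; an increasing sequence in \<open>ereal\<close> converges to its supremum, possibly
  infinite.\<close>

lemma lim_incseq_ge:
  fixes u :: "nat \<Rightarrow> ereal"
  assumes "\<And>m n. 1 \<le> m \<Longrightarrow> m \<le> n \<Longrightarrow> u m \<le> u n" "1 \<le> n"
  shows "u n \<le> lim u"
proof -
  have "incseq (\<lambda>n. u (Suc n))" using assms(1) by (auto simp: incseq_Suc_iff)
  then have "(\<lambda>n. u (Suc n)) \<longlonglongrightarrow> (SUP n. u (Suc n))" by (rule LIMSEQ_SUP)
  then have "lim u = (SUP n. u (Suc n))" by (intro limI) (rule LIMSEQ_imp_Suc)
  moreover have "u n \<le> (SUP n. u (Suc n))"
    using assms(2) by (intro SUP_upper2[of "n - 1"]) auto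
  ultimately show ?thesis by simp
qed

lemma finite_subset_incseq_Union:
  assumes "\<And>m n. 1 \<le> m \<Longrightarrow> m \<le> n \<Longrightarrow> A m \<subseteq> A n" "(\<Union>n\<in>{1::nat..}. A n) = UNIV" "finite S"
  obtains n where "1 \<le> n" "S \<subseteq> A n"
proof -
  have "\<exists>n\<ge>1. S \<subseteq> A n"
    using assms(3)
  proof induction
    case (insert s S)
    then obtain m where m: "1 \<le> m" "S \<subseteq> A m" by blast
    obtain k where k: "1 \<le> k" "s \<in> A k" using assms(2) by (metis UN_E UNIV_I atLeast_iff)
    have "A m \<subseteq> A (max m k)" "A k \<subseteq> A (max m k)" using assms(1) m k by auto
    then show ?case using m k by (intro exI[of _ "max m k"]) auto
  qed auto
  then show ?thesis using that by blast
qed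

theorem lemma2p8:
  fixes r :: "'a::countable \<Rightarrow> 'a \<Rightarrow> real"
    and P :: "'a \<Rightarrow> (real \<Rightarrow> 'a) measure"
    and \<mu> f :: "'a \<Rightarrow> real"
    and A :: "nat \<Rightarrow> 'a set"
    and x :: 'a
  assumes "markov_jump_process r P"
    and "irreducible_process P"
    and "transient_process P"
    and "stationary_measure r \<mu>"
    and "finite {y. f y \<noteq> 0}"
    and "\<And>n. n \<ge> 1 \<Longrightarrow> finite (A n)"
    and "\<And>m n. 1 \<le> m \<Longrightarrow> m \<le> n \<Longrightarrow> A m \<subseteq> A n"
    and "(\<Union>n\<in>{1..}. A n) = UNIV"
  shows "ereal (\<mu> x * (f x)\<^sup>2) \<le>
    enn2ereal (green P x x) *
    lim (\<lambda>n. SUP H\<in>vanishing_off (A n).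
           ereal (2 * inner_mu \<mu> (adj_gen \<mu> r f) H
                  - inner_mu \<mu> H (\<lambda>y. - sym_gen \<mu> r H y)))"
proof -
  interpret markov_jump_process r P by fact
  let ?Q = "\<lambda>H. ereal (2 * inner_mu \<mu> (adj_gen \<mu> r f) H
                  - inner_mu \<mu> H (\<lambda>y. - sym_gen \<mu> r H y))"
  let ?g = "\<lambda>y. enn2real (green P y x)"
  \<comment> \<open>One set of the exhaustion already gives the bound; it must contain both the
    point \<open>x\<close> and the support of \<open>f\<close>.\<close>
  obtain n where n: "1 \<le> n" "insert x {y. f y \<noteq> 0} \<subseteq> A n"
    using finite_subset_incseq_Union[OF assms(7,8)] assms(5) by (metis finite_insert)
  have fin: "finite (A n)" using assms(6) n(1) by blast
  have f: "f \<in> vanishing_off (A n)" and x: "x \<in> A n"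
    using n(2) by (auto simp: vanishing_off_def)
  have super: "(if y = x then 1 else 0) + (\<Sum>z\<in>A n. r y z * ?g z) \<le> holding_rate r y * ?g y" for y
    using green_first_step[OF green_finite[OF assms(3,2)] fin, of y x] by simp
  obtain H where H: "H \<in> vanishing_off (A n)" "0 < H x" "H x \<le> ?g x"
    "\<forall>y\<in>A n. gen r H y = (if y = x then -1 else 0)"
    by (rule killed_green_exists[where g = ?g, OF fin x enn2real_nonneg super])
  let ?c = "\<mu> x * (f x)\<^sup>2"
  have c: "0 \<le> ?c"
    using assms(4) by (simp add: stationary_measure_def less_imp_le)
  note K = variational_lower_bound[OF assms(4) fin f x H(1,2,4)]
  have "ereal (?c / H x) \<le> (SUP H\<in>vanishing_off (A n). ?Q H)"
    using K by (intro SUP_upper2[OF K(1)]) simp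
  also have "\<dots> \<le> lim (\<lambda>n. SUP H\<in>vanishing_off (A n). ?Q H)"
    by (rule lim_incseq_ge[OF _ n(1), where u = "\<lambda>n. SUP H\<in>vanishing_off (A n). ?Q H"], rule SUP_subset_mono)
      (use assms(7) in \<open>auto simp: vanishing_off_def\<close>)
  finally have lim: "ereal (?c / H x) \<le> lim (\<lambda>n. SUP H\<in>vanishing_off (A n). ?Q H)" .
  \<comment> \<open>The killed Green function at \<open>x\<close> is replaced by the larger full
    one.\<close>
  have "?c = H x * (?c / H x)" using H(2) by simp
  also have "\<dots> \<le> ?g x * (?c / H x)" using H(2,3) c by (intro mult_right_mono) auto
  finally have "ereal ?c \<le> ereal (?g x) * ereal (?c / H x)" by simp
  also have "\<dots> \<le> ereal (?g x) * lim (\<lambda>n. SUP H\<in>vanishing_off (A n). ?Q H)"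
    by (intro ereal_mult_left_mono lim) simp
  \<comment> \<open>Finiteness is essential here: \<open>enn2real\<close> sends infinity to
    \<open>0\<close>.\<close>
  also have "ereal (?g x) = enn2ereal (green P x x)"
    using green_finite[OF assms(3,2), of x x] by (cases "green P x x") auto
  finally show ?thesis .
qed

end
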